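(* Consider the Placement problem described in the context with $m \geq 2$ locations, an arbitrary browsing distribution $B$, and a choice model $\phi$ satisfying weak rationality. For each $k \in [m]$, let $S^*_k \subseteq N$ be a set of exactly $k$ products satisfying $R(S^*_k) \geq \alpha \max_{S \subseteq N, |S| \le k} R(S)$ for a fixed $\alpha \in (0,1]$, and let $X^r_k$ be the random placement obtained by placing, at each location $j \in G$ independently, a product chosen uniformly at random from $S^*_k$ (so a product may appear at several locations, and some products of $S^*_k$ may not appear). Then $$\mathbb{E}\Big[\max_{k \in [m]} W(X^r_k)\Big] \;\geq\; \alpha\,\frac{1 - 1/e}{\log_2 m}\,\mathrm{OPT}.$$
   Context: Products: a finite ground set $N$ of $n$ products with prices $r_i \ge 0$; "0" denotes the no-purchase option. A choice model $\phi$ gives, for every $S \subseteq N$ and $i \in S$, a probability $\phi(i,S) \ge 0$ with $\sum_{i \in S}\phi(i,S) \le 1$. Expected revenue: $R(S) = \sum_{i \in S} r_i \phi(i,S)$, $R(\emptyset)=0$. Weak rationality: $\phi(i,S) \ge \phi(i, S \cup \{j\})$ for all $S \subseteq N$, $i \in S$, $j \notin S$. Locations: $G = [m]$. A placement is a map $X: G \to N$; for $L \subseteq G$, $X(L) = \{X(j): j \in L\}$. The browsing distribution $B$ is a probability distribution over subsets $L \subseteq G$, independent of the placement, with $\mathbb{P}_B(L)$ the probability that the customer visits exactly the locations in $L$ and chooses from $X(L)\cup\{0\}$ according to $\phi$. Objective: $W(X) = \sum_{L \subseteq G} \mathbb{P}_B(L) R(X(L))$; $\mathrm{OPT} = \max_X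 W(X)$. The sets $S^*_k$ model the output of an $\alpha$-approximate oracle for cardinality-constrained assortment optimization; by the paper's standing convention each $S^*_k$ has exactly $k$ products (in particular $n \ge m$). The randomness in the expectation is that of the placements $X^r_k$, generated independently for different $k$. *)

theory Defs
  imports "HOL-Probability.Probability"
begin

definition choice_model :: "'a set \<Rightarrow> ('a \<Rightarrow> 'a set \<Rightarrow> real) \<Rightarrow> bool" where
  "choice_model N \<phi> \<longleftrightarrow>
     (\<forall>S. S \<subseteq> N \<longrightarrow> (\<forall>i\<in>S. 0 \<le> \<phi> i S) \<and> (\<Sum>i\<in>S. \<phi> i S) \<le> 1)"

definition weakly_rational :: "'a set \<Rightarrow> ('a \<Rightarrow> 'a set \<Rightarrow> real) \<Rightarrow> bool" where
  "weakly_rational N \<phi> \<longleftrightarrow>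
     (\<forall>S i j. S \<subseteq> N \<longrightarrow> i \<in> S \<longrightarrow> j \<in> N - S \<longrightarrow> \<phi> i S \<ge> \<phi> i (S \<union> {j}))"

definition revenue :: "('a \<Rightarrow> real) \<Rightarrow> ('a \<Rightarrow> 'a set \<Rightarrow> real) \<Rightarrow> 'a set \<Rightarrow> real" where
  "revenue r \<phi> S = (\<Sum>i\<in>S. r i * \<phi> i S)"

definition max_revenue ::
    "'a set \<Rightarrow> ('a \<Rightarrow> real) \<Rightarrow> ('a \<Rightarrow> 'a set \<Rightarrow> real) \<Rightarrow> nat \<Rightarrow> real" where
  "max_revenue N r \<phi> k = Max (revenue r \<phi> ` {S. S \<subseteq> N \<and> card S \<le> k})"

definition locations :: "nat \<Rightarrow> nat set" where
  "locations m = {1..m}"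

text \<open>Placements are extensional functions (\<open>undefined\<close> outside the locations), so that
  there are only finitely many of them.\<close>

definition placements :: "'a set \<Rightarrow> nat \<Rightarrow> (nat \<Rightarrow> 'a) set" where
  "placements N m = locations m \<rightarrow>\<^sub>E N"

definition placement_value ::
    "nat \<Rightarrow> nat set pmf \<Rightarrow> ('a \<Rightarrow> real) \<Rightarrow> ('a \<Rightarrow> 'a set \<Rightarrow> real) \<Rightarrow> (nat \<Rightarrow> 'a) \<Rightarrow> real" where
  "placement_value m B r \<phi> X = (\<Sum>L\<in>Pow (locations m). pmf B L * revenue r \<phi> (X ` L))"

definition opt_value ::
    "'a set \<Rightarrow> nat \<Rightarrow> nat set pmf \<Rightarrow> ('a \<Rightarrow> real) \<Rightarrow> ('a \<Rightarrow> 'a set \<Rightarrow> real) \<Rightarrow> real" where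
  "opt_value N m B r \<phi> = Max (placement_value m B r \<phi> ` placements N m)"

definition random_placement :: "nat \<Rightarrow> 'a set \<Rightarrow> (nat \<Rightarrow> 'a) pmf" where
  "random_placement m S = Pi_pmf (locations m) undefined (\<lambda>_. pmf_of_set S)"

text \<open>Joint law of the random placements for all \<open>k \<in> {1..m}\<close>, independent over \<open>k\<close>.\<close>

definition random_placements :: "nat \<Rightarrow> (nat \<Rightarrow> 'a set) \<Rightarrow> (nat \<Rightarrow> nat \<Rightarrow> 'a) pmf" where
  "random_placements m S = Pi_pmf {1..m} undefined (\<lambda>k. random_placement m (S k))"

end

theory Submission
  imports Defs
begin

text \<open>Let \<open>M k\<close> be the best revenue of an assortment of at most \<open>k\<close> products. Under weak
  rationality \<open>M\<close> is nondecreasing and \<open>M k / k\<close> is nonincreasing, so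
  \<open>M k \<ge> min 1 (k/l) M l\<close>. A customer visiting \<open>l\<close> locations meets a given product of \<open>S k\<close>
  with probability \<open>1 - (1 - 1/k)^l \<ge> (1 - 1/e) min 1 (l/k)\<close>, and each product met is bought at
  least as often as from the whole of \<open>S k\<close>, whereas in any placement this customer yields at most
  \<open>M l\<close>. The maximum over \<open>k\<close> is bounded below by a weighted average, for which one needs
  nonnegative weights of total mass at most \<open>log\<^sub>2 m\<close> with
  \<open>(\<Sum>k. w k * min (k/l) (l/k)) \<ge> 1\<close> for all \<open>l\<close>. Solving these as equations
  gives \<open>w k = 2k / (4k\<^sup>2 - 1)\<close> for \<open>k < m\<close> and \<open>w m = m / (2m - 1)\<close>, of total mass
  \<open>1 + 1/3 + 1/5 + \<dots> + 1/(2m - 1)\<close>, which is at most \<open>log\<^sub>2 m\<close> once \<open>m \<ge> 3\<close>. For \<open>m = 2\<close> this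
  fails, but there the exact probabilities \<open>1 - (1 - 1/k)^l\<close> admit the weights \<open>1/3, 2/3\<close>,
  since \<open>1 - 1/e \<le> 2/3\<close>.\<close>

section \<open>Weak rationality and the best revenue under a cardinality bound\<close>

text \<open>Weak rationality speaks of adding one product only; the products of \<open>S - T\<close>
  are added one by one.\<close>

lemma weakly_rational_mono:
  assumes "finite N" "weakly_rational N \<phi>" "T \<subseteq> S" "S \<subseteq> N" "i \<in> T"
  shows "\<phi> i S \<le> \<phi> i T"
proof -
  have "finite (S - T)" using assms finite_subset by blast
  have "\<phi> i (T \<union> D) \<le> \<phi> i T" if "finite D" "D \<subseteq> S - T" for D
    using that
  proof (induction D)
    case (insert j D)
    have "T \<union> D \<subseteq> N" "i \<in> T \<union> D" "j \<in> N - (T \<union> D)"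
      using insert assms by auto
    then have "\<phi> i (T \<union> D \<union> {j}) \<le> \<phi> i (T \<union> D)"
      using assms(2) unfolding weakly_rational_def by blast
    then show ?case using insert by simp
  qed simp
  from this[of "S - T"] show ?thesis
    using \<open>finite (S - T)\<close> assms(3) by (simp add: Un_absorb1)
qed

lemma finite_revenue_image:
  assumes "finite N"
  shows "finite (revenue r \<phi> ` {S. S \<subseteq> N \<and> card S \<le> k})"
  using assms by simp

lemma revenue_le_max_revenue:
  assumes "finite N" "S \<subseteq> N" "card S \<le> k"
  shows "revenue r \<phi> S \<le> max_revenue N r \<phi> k"
  unfolding max_revenue_def
  by (rule Max_ge) (use finite_revenue_image[OF assms(1)] assms in auto)

lemma max_revenue_attained:
  assumes "finite N"
  obtains S where "S \<subseteq> N" "card S \<le> k" "max_revenue N r \<phi> k = revenue r \<phi> S"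
proof -
  have "max_revenue N r \<phi> k \<in> revenue r \<phi> ` {S. S \<subseteq> N \<and> card S \<le> k}"
    unfolding max_revenue_def
    by (rule Max_in[OF finite_revenue_image[OF assms]]) (auto intro!: exI[of _ "{}"])
  then show ?thesis using that by auto
qed

lemma max_revenue_mono:
  assumes "finite N" "k \<le> l"
  shows "max_revenue N r \<phi> k \<le> max_revenue N r \<phi> l"
proof -
  obtain S where "S \<subseteq> N" "card S \<le> k" "max_revenue N r \<phi> k = revenue r \<phi> S"
    using max_revenue_attained[OF assms(1)] .
  then show ?thesis using revenue_le_max_revenue[OF assms(1), of S l r \<phi>] assms(2) by simp
qed

lemma max_revenue_nonneg:
  assumes "finite N"
  shows "0 \<le> max_revenue N r \<phi> k"
  using revenue_le_max_revenue[OF assms, of "{}" k r \<phi>] by (simp add: revenue_def)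

lemma max_revenue_0:
  assumes "finite N"
  shows "max_revenue N r \<phi> 0 = 0"
proof -
  obtain S where "S \<subseteq> N" "card S \<le> 0" "max_revenue N r \<phi> 0 = revenue r \<phi> S"
    using max_revenue_attained[OF assms] .
  then show ?thesis using finite_subset[OF _ assms, of S] by (simp add: revenue_def)
qed

text \<open>Discarding the product that contributes least to an optimal assortment costs at most an
  average share, since by weak rationality the other contributions only grow.\<close>

lemma max_revenue_Suc:
  assumes "finite N" "\<And>i. i \<in> N \<Longrightarrow> 0 \<le> r i" "weakly_rational N \<phi>"
  shows "real l * max_revenue N r \<phi> (Suc l) \<le> real (Suc l) * max_revenue N r \<phi> l"
proof -
  let ?M = "max_revenue N r \<phi>"
  obtain S where S: "S \<subseteq> N" "card S \<le> Suc l" "?M (Suc l) = revenue r \<phi> S"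
    using max_revenue_attained[OF assms(1)] .
  have fin: "finite S" using S(1) assms(1) finite_subset by blast
  show ?thesis
  proof (cases "card S \<le> l")
    case True
    then have "?M (Suc l) \<le> ?M l"
      using S revenue_le_max_revenue[OF assms(1)] by metis
    then have "real l * ?M (Suc l) \<le> real l * ?M l" by (intro mult_left_mono) auto
    also have "\<dots> \<le> real (Suc l) * ?M l"
      using max_revenue_nonneg[OF assms(1)] by (intro mult_right_mono) auto
    finally show ?thesis .
  next
    case False
    then have card: "card S = Suc l" using S by simp
    define R where "R = revenue r \<phi> S"
    obtain i where i: "i \<in> S" "real (Suc l) * (r i * \<phi> i S) \<le> R"
    proof (rule ccontr)
      assume "\<not> thesis"
      then have "\<And>i. i \<in> S \<Longrightarrow> R < real (Suc l) * (r i * \<phi> i S)" using that by force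
      then have "(\<Sum>i\<in>S. R) < (\<Sum>i\<in>S. real (Suc l) * (r i * \<phi> i S))"
        using card by (intro sum_strict_mono fin) auto
      also have "\<dots> = real (Suc l) * R" by (simp add: R_def revenue_def sum_distrib_left)
      finally show False using card by simp
    qed
    have "R - r i * \<phi> i S = (\<Sum>j\<in>S - {i}. r j * \<phi> j S)"
      using fin i by (simp add: R_def revenue_def sum_diff1)
    also have "\<dots> \<le> revenue r \<phi> (S - {i})"
      unfolding revenue_def
      by (intro sum_mono mult_left_mono weakly_rational_mono[OF assms(1,3)]) (use S assms in auto)
    also have "\<dots> \<le> ?M l"
      by (rule revenue_le_max_revenue[OF assms(1)]) (use S card i fin in auto)
    finally have "real (Suc l) * (R - r i * \<phi> i S) \<le> real (Suc l) * ?M l"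
      by (intro mult_left_mono) auto
    then show ?thesis using i S(3) by (simp add: R_def algebra_simps)
  qed
qed

lemma max_revenue_div_antimono:
  assumes "finite N" "\<And>i. i \<in> N \<Longrightarrow> 0 \<le> r i" "weakly_rational N \<phi>" "0 < k" "k \<le> l"
  shows "max_revenue N r \<phi> l / real l \<le> max_revenue N r \<phi> k / real k"
  using assms(5)
proof (induction l rule: dec_induct)
  case (step l)
  have "max_revenue N r \<phi> (Suc l) / real (Suc l) \<le> max_revenue N r \<phi> l / real l"
    using max_revenue_Suc[where l = l, OF assms(1-3)] step.hyps assms(4) by (simp add: field_simps)
  then show ?case using step.IH by linarith
qed simp

text \<open>For \<open>k \<le> l\<close> this is the decrease of the revenue per product, for
  \<open>k > l\<close> the plain monotonicity in the bound.\<close>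

lemma max_revenue_ge_min:
  assumes "finite N" "\<And>i. i \<in> N \<Longrightarrow> 0 \<le> r i" "weakly_rational N \<phi>" "0 < k" "0 < l"
  shows "min 1 (real k / real l) * max_revenue N r \<phi> l \<le> max_revenue N r \<phi> k"
proof (cases "k \<le> l")
  case True
  then show ?thesis
    using max_revenue_div_antimono[where k = k and l = l, OF assms(1-4)] assms(4,5)
    by (simp add: field_simps min_def)
next
  case False
  then show ?thesis using max_revenue_mono[OF assms(1), of l k r \<phi>] assms(5)
    by (simp add: min_def)
qed

section \<open>Hitting probabilities and averaging weights\<close>

text \<open>With \<open>x = l / k\<close>, the miss probability is at most \<open>exp (- x)\<close>.
  On [0, 1] the convex function \<open>exp (- x)\<close> lies below its chord, which gives the
  factor \<open>1 - 1 / exp 1\<close>; beyond 1 monotonicity suffices.\<close>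

lemma hitting_probability_ge:
  assumes "0 < k"
  shows "(1 - 1 / exp 1) * min 1 (real l / real k) \<le> 1 - (1 - 1 / real k) ^ l"
proof -
  define x where "x = real l / real k"
  have "(1 - 1 / real k) ^ l \<le> exp (- (1 / real k)) ^ l"
    using exp_ge_add_one_self[of "- (1 / real k)"] assms by (intro power_mono) auto
  also have "\<dots> = exp (- x)"
    by (simp add: x_def exp_of_nat_mult[symmetric])
  finally have le: "(1 - 1 / real k) ^ l \<le> exp (- x)" .
  show ?thesis
  proof (cases "x \<le> 1")
    case True
    have "exp ((1 - x) *\<^sub>R 0 + x *\<^sub>R (-1)) \<le> (1 - x) * exp 0 + x * exp (-1::real)"
      by (rule convex_onD[OF exp_convex]) (use True in \<open>auto simp: x_def\<close>)
    then have "exp (- x) \<le> 1 - (1 - exp (-1)) * x" by (simp add: algebra_simps)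
    then show ?thesis using le True
      by (simp add: x_def[symmetric] min_def exp_minus inverse_eq_divide)
  next
    case False
    then have "exp (- x) \<le> exp (-1)" by simp
    then show ?thesis using le False
      by (simp add: x_def[symmetric] min_def exp_minus inverse_eq_divide)
  qed
qed

text \<open>The last weight makes up for the truncation at \<open>m\<close>:
  \<open>w m / m = 1 / (2 * m - 1)\<close> is the whole tail sum of \<open>2 / (4 * k^2 - 1)\<close>
  over \<open>k \<ge> m\<close>.\<close>

definition scale_weight :: "nat \<Rightarrow> nat \<Rightarrow> real" where
  "scale_weight m k = (if k = m then real m / (2 * real m - 1) else 2 * real k / (4 * real k ^ 2 - 1))"

text \<open>The summand is the increment of the right-hand side, so the sum telescopes.\<close>

lemma sum_scale_weight_below:
  "(\<Sum>k=1..l. real k * (2 * real k / (4 * real k ^ 2 - 1)))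
     = real l * (real l + 1) / (2 * real l + 1)"
proof (induction l)
  case (Suc l)
  have nz: "2 * real l + 1 \<noteq> 0" "2 * real l + 3 \<noteq> 0" by linarith+
  have eq: "4 * real (Suc l) ^ 2 - 1 = (2 * real l + 1) * (2 * real l + 3)"
    by (simp add: power2_eq_square algebra_simps)
  have "real (Suc l) * (2 * real (Suc l) / (4 * real (Suc l) ^ 2 - 1)) =
     real (Suc l) * (real (Suc l) + 1) / (2 * real (Suc l) + 1) - real l * (real l + 1) / (2 * real l + 1)"
    unfolding eq using nz by (simp add: divide_simps) (simp add: algebra_simps)
  then show ?case using Suc by simp
qed simp

text \<open>Telescopes by partial fractions:
  \<open>2 / (4 * k^2 - 1) = 1 / (2 * k - 1) - 1 / (2 * k + 1)\<close>.\<close>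

lemma sum_scale_weight_above:
  assumes "l < m"
  shows "(\<Sum>k=Suc l..<m. 2 * real k / (4 * real k ^ 2 - 1) / real k)
     = 1 / (2 * real l + 1) - 1 / (2 * real m - 1)"
proof -
  have "Suc l \<le> m" using assms by simp
  then show ?thesis
  proof (induction m rule: dec_induct)
    case (step n)
    have "0 < real n" "2 * real n - 1 > 0" "2 * real n + 1 > 0" using step by linarith+
    moreover have "4 * real n ^ 2 - 1 = (2 * real n - 1) * (2 * real n + 1)"
      by (simp add: power2_eq_square algebra_simps)
    ultimately have "2 * real n / (4 * real n ^ 2 - 1) / real n
        = 1 / (2 * real n - 1) - 1 / (2 * real n + 1)"
      by (simp add: divide_simps)
    then show ?case using step by simp
  qed simp
qed

text \<open>The kernel is \<open>k / l\<close> up to the diagonal and \<open>l / k\<close> beyond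
  it, so the two telescoping sums apply. For \<open>l < m\<close> the two ranges contribute
  \<open>(l + 1) / (2 * l + 1)\<close> and \<open>l / (2 * l + 1)\<close>.\<close>

lemma scale_weight_kernel:
  assumes "1 \<le> l" "l \<le> m"
  shows "(\<Sum>k=1..m. scale_weight m k * (min 1 (real l / real k) * min 1 (real k / real l))) = 1"
    (is "(\<Sum>k=1..m. ?f k) = 1")
proof -
  have f: "?f k = scale_weight m k * (if k \<le> l then real k / real l else real l / real k)"
    if "1 \<le> k" for k
    using that assms by (simp add: min_def field_simps)
  have below: "(\<Sum>k=1..n. ?f k) = real n * (real n + 1) / (2 * real n + 1) / real l"
    if "n \<le> l" "n < m" for n
  proof -
    have "(\<Sum>k=1..n. ?f k) = (\<Sum>k=1..n. real k * (2 * real k / (4 * real k ^ 2 - 1)) / real l)"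
      using that by (intro sum.cong refl) (simp add: f scale_weight_def)
    also have "\<dots> = real n * (real n + 1) / (2 * real n + 1) / real l"
      unfolding sum_divide_distrib[symmetric] sum_scale_weight_below ..
    finally show ?thesis .
  qed
  show ?thesis
  proof (cases "l = m")
    case True
    obtain n where n: "m = Suc n" using assms by (cases m) auto
    have "(\<Sum>k=1..m. ?f k) = (\<Sum>k=1..n. ?f k) + ?f m" unfolding n by simp
    also have "\<dots> = real n * (real n + 1) / (2 * real n + 1) / real m + real m / (2 * real m - 1)"
      using below[of n] True n assms by (simp add: scale_weight_def)
    also have "\<dots> = real n / (2 * real n + 1) + (real n + 1) / (2 * real n + 1)"
      unfolding n by simp (simp add: add_ac)
    also have "\<dots> = 1" by (simp add: add_divide_distrib[symmetric])
    finally show ?thesis .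
  next
    case False
    then have lm: "l < m" using assms by simp
    have split: "{1..m} = {1..l} \<union> ({Suc l..<m} \<union> {m})" using lm assms by auto
    have "(\<Sum>k=1..m. ?f k) = (\<Sum>k=1..l. ?f k) + ((\<Sum>k=Suc l..<m. ?f k) + ?f m)"
      unfolding split using lm
      by (subst sum.union_disjoint; (subst sum.union_disjoint)?) auto
    also have "(\<Sum>k=Suc l..<m. ?f k)
        = (\<Sum>k=Suc l..<m. real l * (2 * real k / (4 * real k ^ 2 - 1) / real k))"
      by (intro sum.cong refl, subst f) (auto simp: scale_weight_def)
    also have "\<dots> = real l * (1 / (2 * real l + 1) - 1 / (2 * real m - 1))"
      unfolding sum_distrib_left[symmetric] sum_scale_weight_above[OF lm] ..
    \<comment> \<open>The last weight cancels the deficit \<open>1 / (2 * m - 1)\<close> left by the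
      telescoping sum.\<close>
    also have "?f m = real l * (1 / (2 * real m - 1))"
      using lm by (subst f) (auto simp: scale_weight_def)
    also have "(\<Sum>k=1..l. ?f k) = (real l + 1) / (2 * real l + 1)"
      using below[of l] lm assms by simp
    finally show ?thesis by (simp add: right_diff_distrib add_divide_distrib[symmetric])
  qed
qed

text \<open>Passing from \<open>n\<close> to \<open>n + 1\<close> replaces the boundary weight at
  \<open>n\<close> by the interior one and adds a new boundary weight; the net change is
  \<open>1 / (2 * n + 1)\<close>.\<close>

lemma sum_scale_weight:
  assumes "1 \<le> m"
  shows "(\<Sum>k=1..m. scale_weight m k) = 1 + (\<Sum>k=1..<m. 1 / (2 * real k + 1))"
proof -
  have *: "(\<Sum>k=1..<m. 2 * real k / (4 * real k ^ 2 - 1)) + real m / (2 * real m - 1)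
      = 1 + (\<Sum>k=1..<m. 1 / (2 * real k + 1))"
    using assms
  proof (induction m rule: dec_induct)
    case (step n)
    have "0 < real n" "2 * real n - 1 > 0" "2 * real n + 1 > 0" using step by linarith+
    moreover have "4 * real n ^ 2 - 1 = (2 * real n - 1) * (2 * real n + 1)"
      by (simp add: power2_eq_square algebra_simps)
    ultimately have "2 * real n / (4 * real n ^ 2 - 1) + real (Suc n) / (2 * real (Suc n) - 1)
        - real n / (2 * real n - 1) = 1 / (2 * real n + 1)"
      by (simp add: divide_simps) (simp add: algebra_simps)
    then show ?case using step by simp
  qed simp
  have "{1..m} = insert m {1..<m}" using assms by auto
  then have "(\<Sum>k=1..m. scale_weight m k) = scale_weight m m + (\<Sum>k=1..<m. scale_weight m k)"
    by simp
  also have "(\<Sum>k=1..<m. scale_weight m k) = (\<Sum>k=1..<m. 2 * real k / (4 * real k ^ 2 - 1))"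
    by (intro sum.cong) (auto simp: scale_weight_def)
  finally show ?thesis using * by (simp add: scale_weight_def)
qed

lemma sum_scale_weight_le_log:
  assumes "3 \<le> m"
  shows "(\<Sum>k=1..m. scale_weight m k) \<le> log 2 (real m)"
proof -
  have "1 + (\<Sum>k=1..<m. 1 / (2 * real k + 1)) \<le> log 2 (real m)"
    using assms
  proof (induction m rule: dec_induct)
    case base
    \<comment> \<open>The sum for \<open>m = 3\<close> is 1 + 1/3 + 1/5 = 23/15, and
      \<open>2 ^ 23 \<le> 3 ^ 15\<close>.\<close>
    have "23 = log 2 (2 ^ 23 :: real)" by (subst log_nat_power) auto
    also have "\<dots> \<le> log 2 (3 ^ 15)" by (subst log_le_cancel_iff) auto
    also have "\<dots> = 15 * log 2 3" by (subst log_nat_power) auto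
    finally have "23 / 15 \<le> log 2 (3::real)" by simp
    moreover have "{1..<3::nat} = {1, 2}" by auto
    ultimately show ?case by simp
  next
    case (step n)
    define x where "x = real n / real (Suc n)"
    have x: "0 < x" using step by (simp add: x_def)
    \<comment> \<open>Here \<open>1 - x = 1 / (n + 1)\<close>, which is in turn at most the
      increment of \<open>ln\<close>, hence that of \<open>log 2\<close>.\<close>
    have "1 / (2 * real n + 1) \<le> 1 - x"
      using step by (simp add: x_def field_simps)
    also have "\<dots> \<le> - ln x" using ln_le_minus_one[OF x] by linarith
    also have "\<dots> = ln (real (Suc n)) - ln (real n)"
      using step by (simp add: x_def ln_div del: of_nat_Suc)
    also have "\<dots> \<le> (ln (real (Suc n)) - ln (real n)) / ln 2"
    proof -
      have "ln 2 \<le> (1::real)" using ln_le_minus_one[of "2::real"] by simp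
      moreover have "0 \<le> ln (real (Suc n)) - ln (real n)" using step by simp
      ultimately show ?thesis by (simp add: le_divide_eq mult_left_le)
    qed
    also have "\<dots> = log 2 (real (Suc n)) - log 2 (real n)"
      by (simp add: log_def diff_divide_distrib)
    finally show ?case using step by simp
  qed
  then show ?thesis using sum_scale_weight[of m] assms by simp
qed

text \<open>In the last property the first factor is the chance that \<open>l\<close> visits meet a
  given product of \<open>S k\<close>, the second the revenue kept when \<open>k\<close> products
  replace \<open>l\<close>.\<close>

lemma averaging_weights_exist:
  assumes "2 \<le> m"
  obtains w :: "nat \<Rightarrow> real" where
    "\<And>k. k \<in> {1..m} \<Longrightarrow> 0 \<le> w k"
    "(\<Sum>k=1..m. w k) \<le> log 2 (real m)"
    "\<And>l. l \<in> {1..m} \<Longrightarrow> 1 - 1 / exp 1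
       \<le> (\<Sum>k=1..m. w k * ((1 - (1 - 1 / real k) ^ l) * min 1 (real k / real l)))"
proof (cases "m = 2")
  case True
  \<comment> \<open>These weights have total 1 = \<open>log 2 2\<close>, and the weighted sum equals
    2/3 for both \<open>l = 1\<close> and \<open>l = 2\<close>.\<close>
  define w :: "nat \<Rightarrow> real" where "w k = real k / 3" for k
  have I: "{1..m} = {1, 2}" using True by auto
  have c: "1 - 1 / exp 1 \<le> (2/3 :: real)" using exp_le by (simp add: field_simps)
  show ?thesis
  proof (rule that[of w])
    fix l assume "l \<in> {1..m}"
    then consider "l = 1" | "l = 2" unfolding I by blast
    then show "1 - 1 / exp 1
       \<le> (\<Sum>k=1..m. w k * ((1 - (1 - 1 / real k) ^ l) * min 1 (real k / real l)))"
      unfolding I using c by cases (simp_all add: w_def power2_eq_square)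
  next
    show "(\<Sum>k=1..m. w k) \<le> log 2 (real m)" unfolding I using True by (simp add: w_def)
  qed (simp add: w_def)
next
  case False
  then have m: "3 \<le> m" using assms by simp
  have w0: "0 \<le> scale_weight m k" if "k \<in> {1..m}" for k
  proof -
    have "1 \<le> real k ^ 2" using that by simp
    then have "0 \<le> 4 * real k ^ 2 - 1" by linarith
    then show ?thesis using that by (auto simp: scale_weight_def intro!: divide_nonneg_nonneg)
  qed
  show ?thesis
  proof (rule that[of "scale_weight m"])
    fix l assume l: "l \<in> {1..m}"
    have "1 - 1 / exp 1 = (1 - 1 / exp 1) *
        (\<Sum>k=1..m. scale_weight m k * (min 1 (real l / real k) * min 1 (real k / real l)))"
      using scale_weight_kernel[of l m] l by simp
    also have "\<dots> = (\<Sum>k=1..m. scale_weight m k *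
        (((1 - 1 / exp 1) * min 1 (real l / real k)) * min 1 (real k / real l)))"
      by (simp add: sum_distrib_left mult_ac)
    also have "\<dots> \<le> (\<Sum>k=1..m. scale_weight m k *
        ((1 - (1 - 1 / real k) ^ l) * min 1 (real k / real l)))"
      by (intro sum_mono mult_left_mono mult_right_mono hitting_probability_ge w0) auto
    finally show "1 - 1 / exp 1 \<le> (\<Sum>k=1..m. scale_weight m k *
        ((1 - (1 - 1 / real k) ^ l) * min 1 (real k / real l)))" .
  qed (use w0 sum_scale_weight_le_log[OF m] in auto)
qed

section \<open>Expected value of a random placement\<close>

text \<open>Missing \<open>i\<close> on \<open>L\<close> is a product event, with no constraint
  outside \<open>L\<close>, so independence multiplies the \<open>card L\<close> single-location
  miss probabilities.\<close>

lemma prob_placed: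
  assumes "finite S" "S \<noteq> {}" "i \<in> S" "L \<subseteq> locations m"
  shows "measure_pmf.prob (random_placement m S) {X. i \<in> X ` L} = 1 - (1 - 1 / real (card S)) ^ card L"
proof -
  let ?P = "random_placement m S"
  have fin: "finite (locations m)" by (simp add: locations_def)
  have "measure_pmf.prob ?P {X. i \<notin> X ` L}
      = measure_pmf.prob ?P (Pi (locations m) (\<lambda>j. if j \<in> L then - {i} else UNIV))"
    using assms(4) by (intro arg_cong[where f = "measure_pmf.prob ?P"]) (auto simp: Pi_def)
  also have "\<dots> = (\<Prod>j\<in>locations m.
      measure_pmf.prob (pmf_of_set S) (if j \<in> L then - {i} else UNIV))"
    unfolding random_placement_def by (rule measure_Pi_pmf_Pi[OF fin])
  also have "\<dots> = (\<Prod>j\<in>locations m. if j \<in> L then 1 - 1 / real (card S) else 1)"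
  proof (intro prod.cong refl)
    have "measure_pmf.prob (pmf_of_set S) (- {i}) = 1 - measure_pmf.prob (pmf_of_set S) {i}"
      using measure_pmf.prob_compl[of "{i}" "pmf_of_set S"] by (simp add: Compl_eq_Diff_UNIV)
    then show "measure_pmf.prob (pmf_of_set S) (if j \<in> L then - {i} else UNIV)
        = (if j \<in> L then 1 - 1 / real (card S) else 1)" for j
      using assms by (simp add: measure_pmf_single)
  qed
  also have "\<dots> = (1 - 1 / real (card S)) ^ card L"
    using fin assms(4) by (simp add: prod.If_cases Int_absorb1)
  finally have "measure_pmf.prob ?P {X. i \<notin> X ` L} = (1 - 1 / real (card S)) ^ card L" .
  moreover have "measure_pmf.prob ?P {X. i \<in> X ` L} = 1 - measure_pmf.prob ?P {X. i \<notin> X ` L}"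
    using measure_pmf.prob_compl[of "{X. i \<notin> X ` L}" ?P]
    by (simp add: Compl_eq_Diff_UNIV[symmetric] Collect_neg_eq[symmetric])
  ultimately show ?thesis by simp
qed

text \<open>Finite support makes every real function integrable under this law.\<close>

lemma finite_set_random_placement:
  assumes "finite S" "S \<noteq> {}"
  shows "finite (set_pmf (random_placement m S))"
  using assms unfolding random_placement_def
  by (auto simp: set_Pi_pmf locations_def intro!: finite_PiE_dflt)

lemma random_placement_image_subset:
  assumes "finite S" "S \<noteq> {}" "X \<in> set_pmf (random_placement m S)" "L \<subseteq> locations m"
  shows "X ` L \<subseteq> S"
  using assms unfolding random_placement_def
  by (auto simp: set_Pi_pmf locations_def PiE_dflt_def)

text \<open>Revenue is not additive in the products shown, but weak rationality bounds it below by
  the sum of \<open>r i * \<phi> i S\<close> over them. This bound is linear in the indicators of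
  being shown, so its expectation follows from the hitting probabilities.\<close>

lemma expectation_revenue_ge:
  assumes "finite N" "\<And>i. i \<in> N \<Longrightarrow> 0 \<le> r i" "weakly_rational N \<phi>"
    and S: "S \<subseteq> N" "S \<noteq> {}" and L: "L \<subseteq> locations m"
  shows "(1 - (1 - 1 / real (card S)) ^ card L) * revenue r \<phi> S
     \<le> measure_pmf.expectation (random_placement m S) (\<lambda>X. revenue r \<phi> (X ` L))"
proof -
  let ?P = "random_placement m S"
  have fin: "finite S" using S(1) assms(1) finite_subset by blast
  note int = integrable_measure_pmf_finite[OF finite_set_random_placement[OF fin S(2), of m]]
  have "(1 - (1 - 1 / real (card S)) ^ card L) * revenue r \<phi> S
      = (\<Sum>i\<in>S. r i * \<phi> i S * measure_pmf.prob ?P {X. i \<in> X ` L})"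
    unfolding revenue_def sum_distrib_left
    by (intro sum.cong refl) (simp add: prob_placed[OF fin S(2) _ L])
  also have "\<dots> = (\<Sum>i\<in>S. r i * \<phi> i S * measure_pmf.expectation ?P (indicator {X. i \<in> X ` L}))"
    by simp
  also have "\<dots> = measure_pmf.expectation ?P
      (\<lambda>X. \<Sum>i\<in>S. r i * \<phi> i S * indicator {X. i \<in> X ` L} X)"
    by (subst Bochner_Integration.integral_sum) (auto intro: int)
  also have "\<dots> \<le> measure_pmf.expectation ?P (\<lambda>X. revenue r \<phi> (X ` L))"
  proof (intro integral_mono_AE int, unfold AE_measure_pmf_iff, intro ballI)
    fix X assume X: "X \<in> set_pmf ?P"
    have sub: "X ` L \<subseteq> S" by (rule random_placement_image_subset[OF fin S(2) X L])
    have "(\<Sum>i\<in>S. r i * \<phi> i S * indicator {X. i \<in> X ` L} X) = (\<Sum>i\<in>X ` L. r i * \<phi> i S)"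
      using sub fin by (intro sum.mono_neutral_cong_right) auto
    also have "\<dots> \<le> revenue r \<phi> (X ` L)"
      unfolding revenue_def
      by (intro sum_mono mult_left_mono weakly_rational_mono[OF assms(1,3) sub S(1)])
        (use sub S assms in auto)
    finally show "(\<Sum>i\<in>S. r i * \<phi> i S * indicator {X. i \<in> X ` L} X) \<le> revenue r \<phi> (X ` L)" .
  qed
  finally show ?thesis .
qed

lemma expectation_placement_value_ge:
  assumes "finite N" "\<And>i. i \<in> N \<Longrightarrow> 0 \<le> r i" "weakly_rational N \<phi>" "S \<subseteq> N" "S \<noteq> {}"
  shows "(\<Sum>L\<in>Pow (locations m). pmf B L * ((1 - (1 - 1 / real (card S)) ^ card L) * revenue r \<phi> S))
     \<le> measure_pmf.expectation (random_placement m S) (placement_value m B r \<phi>)"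
proof -
  let ?P = "random_placement m S"
  have fin: "finite S" using assms finite_subset by blast
  note int = integrable_measure_pmf_finite[OF finite_set_random_placement[OF fin assms(5), of m]]
  have "measure_pmf.expectation ?P (placement_value m B r \<phi>)
      = (\<Sum>L\<in>Pow (locations m). pmf B L * measure_pmf.expectation ?P (\<lambda>X. revenue r \<phi> (X ` L)))"
    unfolding placement_value_def
    by (subst Bochner_Integration.integral_sum) (auto intro: int)
  then show ?thesis
    by (auto intro!: sum_mono mult_left_mono expectation_revenue_ge[OF assms])
qed

text \<open>The law of \<open>X k\<close> under the joint law is
  \<open>random_placement m (S k)\<close>, and the maximum dominates each of its entries
  pointwise.\<close>

lemma expectation_Max_ge:
  fixes f :: "(nat \<Rightarrow> 'a) \<Rightarrow> real"
  assumes S: "\<And>k. k \<in> {1..m} \<Longrightarrow> finite (S k) \<and> S k \<noteq> {}" and k: "k \<in> {1..m}"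
  shows "measure_pmf.expectation (random_placement m (S k)) f
     \<le> measure_pmf.expectation (random_placements m S) (\<lambda>X. Max ((\<lambda>k. f (X k)) ` {1..m}))"
proof -
  let ?P = "random_placements m S"
  have fin: "finite (set_pmf ?P)"
    unfolding random_placements_def
    using S by (auto simp: set_Pi_pmf intro!: finite_PiE_dflt finite_set_random_placement)
  have "random_placement m (S k) = map_pmf (\<lambda>X. X k) ?P"
    unfolding random_placements_def using k by (simp add: Pi_pmf_component)
  then have "measure_pmf.expectation (random_placement m (S k)) f
      = measure_pmf.expectation ?P (\<lambda>X. f (X k))" by simp
  also have "\<dots> \<le> measure_pmf.expectation ?P (\<lambda>X. Max ((\<lambda>k. f (X k)) ` {1..m}))"
    by (intro integral_mono integrable_measure_pmf_finite fin Max_ge) (use k in auto)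
  finally show ?thesis .
qed

section \<open>Upper bound on the optimum and averaging over \<open>k\<close>\<close>

text \<open>Whatever the placement, visiting \<open>L\<close> reveals at most \<open>card L\<close>
  distinct products.\<close>

lemma opt_value_le:
  assumes "finite N" "N \<noteq> {}"
  shows "opt_value N m B r \<phi>
     \<le> (\<Sum>L\<in>Pow (locations m). pmf B L * max_revenue N r \<phi> (card L))"
proof -
  have fin: "finite (locations m)" by (simp add: locations_def)
  have ne: "placements N m \<noteq> {}" using assms by (simp add: placements_def PiE_eq_empty_iff)
  have "finite (placements N m)" using assms fin by (auto simp: placements_def intro: finite_PiE)
  then show ?thesis
    unfolding opt_value_def
  proof (subst Max_le_iff, safe)
    fix X assume X: "X \<in> placements N m"
    show "placement_value m B r \<phi> X
        \<le> (\<Sum>L\<in>Pow (locations m). pmf B L * max_revenue N r \<phi> (card L))"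
      unfolding placement_value_def
    proof (intro sum_mono mult_left_mono revenue_le_max_revenue assms)
      fix L assume L: "L \<in> Pow (locations m)"
      then show "X ` L \<subseteq> N" using X by (auto simp: placements_def)
      show "card (X ` L) \<le> card L" using L fin finite_subset by (intro card_image_le) auto
    qed simp
  qed (use ne in auto)
qed

theorem theorem3:
  fixes N :: "'a set" and r :: "'a \<Rightarrow> real" and \<phi> :: "'a \<Rightarrow> 'a set \<Rightarrow> real"
    and m :: nat and B :: "nat set pmf" and S :: "nat \<Rightarrow> 'a set" and \<alpha> :: real
  assumes "finite N"
    and "\<And>i. i \<in> N \<Longrightarrow> 0 \<le> r i"
    and "choice_model N \<phi>"
    and "weakly_rational N \<phi>"
    and "m \<ge> 2"
    and "set_pmf B \<subseteq> Pow (locations m)"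
    and "0 < \<alpha>" and "\<alpha> \<le> 1"
    and "\<And>k. k \<in> {1..m} \<Longrightarrow> S k \<subseteq> N"
    and "\<And>k. k \<in> {1..m} \<Longrightarrow> card (S k) = k"
    and "\<And>k. k \<in> {1..m} \<Longrightarrow> revenue r \<phi> (S k) \<ge> \<alpha> * max_revenue N r \<phi> k"
  shows "measure_pmf.expectation (random_placements m S)
           (\<lambda>X. Max ((\<lambda>k. placement_value m B r \<phi> (X k)) ` {1..m}))
         \<ge> \<alpha> * ((1 - 1 / exp 1) / log 2 (real m)) * opt_value N m B r \<phi>"
proof -
  define M where "M = max_revenue N r \<phi>"
  define g :: "nat \<Rightarrow> nat \<Rightarrow> real" where "g k l = 1 - (1 - 1 / real k) ^ l" for k l
  define c :: real where "c = 1 - 1 / exp 1"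
  define E where "E = measure_pmf.expectation (random_placements m S)
           (\<lambda>X. Max ((\<lambda>k. placement_value m B r \<phi> (X k)) ` {1..m}))"
  define \<L> where "\<L> = Pow (locations m)"
  have M0: "0 \<le> M k" for k
    unfolding M_def by (rule max_revenue_nonneg[OF assms(1)])
  have g0: "0 \<le> g k l" if "1 \<le> k" for k l
    using that unfolding g_def by (simp add: power_le_one)
  have S: "finite (S k) \<and> S k \<noteq> {}" if "k \<in> {1..m}" for k
    using finite_subset[OF assms(9)[OF that] assms(1)] assms(10)[OF that] that by auto
  have N: "N \<noteq> {}" using S[of 1] assms(9)[of 1] assms(5) by auto
  have E: "\<alpha> * (\<Sum>L\<in>\<L>. pmf B L * (g k (card L) * M k)) \<le> E" if k: "k \<in> {1..m}" for k
  proof -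
    have "\<alpha> * (\<Sum>L\<in>\<L>. pmf B L * (g k (card L) * M k))
        = (\<Sum>L\<in>\<L>. pmf B L * (g k (card L) * (\<alpha> * M k)))"
      by (simp add: sum_distrib_left mult_ac)
    also have "\<dots> \<le> (\<Sum>L\<in>\<L>. pmf B L * (g k (card L) * revenue r \<phi> (S k)))"
      using k assms(11)[OF k] by (intro sum_mono mult_left_mono g0) (auto simp: M_def)
    also have "\<dots> \<le> measure_pmf.expectation (random_placement m (S k)) (placement_value m B r \<phi>)"
      using expectation_placement_value_ge[where S = "S k" and m = m and B = B, OF assms(1,2,4) assms(9)[OF k]]
        S[OF k] assms(10)[OF k] by (simp add: g_def \<L>_def)
    also have "\<dots> \<le> E"
      unfolding E_def using expectation_Max_ge[where S = S, OF S k] .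
    finally show ?thesis .
  qed
  obtain w :: "nat \<Rightarrow> real" where w: "\<And>k. k \<in> {1..m} \<Longrightarrow> 0 \<le> w k"
      "(\<Sum>k=1..m. w k) \<le> log 2 (real m)"
      "\<And>l. l \<in> {1..m} \<Longrightarrow> c \<le> (\<Sum>k=1..m. w k * (g k l * min 1 (real k / real l)))"
    using averaging_weights_exist[OF assms(5)] unfolding g_def c_def by blast
  have avg: "c * M l \<le> (\<Sum>k=1..m. w k * (g k l * M k))" if "l \<le> m" for l
  proof (cases "l = 0")
    \<comment> \<open>The weights cover only \<open>l \<ge> 1\<close>; a customer visiting no
      location yields nothing on either side.\<close>
    case True
    then show ?thesis using max_revenue_0[OF assms(1), of r \<phi>] by (simp add: M_def g_def)
  next
    case False
    then have "c * M l \<le> (\<Sum>k=1..m. w k * (g k l * min 1 (real k / real l))) * M l"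
      using that by (intro mult_right_mono w(3) M0) auto
    also have "\<dots> = (\<Sum>k=1..m. w k * (g k l * (min 1 (real k / real l) * M l)))"
      by (simp only: sum_distrib_right mult.assoc)
    also have "\<dots> \<le> (\<Sum>k=1..m. w k * (g k l * M k))"
      unfolding M_def using False
      by (intro sum_mono mult_left_mono w(1) g0 max_revenue_ge_min assms) auto
    finally show ?thesis .
  qed
  have "c * opt_value N m B r \<phi> \<le> c * (\<Sum>L\<in>\<L>. pmf B L * M (card L))"
    unfolding M_def \<L>_def c_def by (intro mult_left_mono opt_value_le assms N) simp
  also have "\<dots> = (\<Sum>L\<in>\<L>. pmf B L * (c * M (card L)))"
    by (simp add: sum_distrib_left mult_ac)
  also have "\<dots> \<le> (\<Sum>L\<in>\<L>. pmf B L * (\<Sum>k=1..m. w k * (g k (card L) * M k)))"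
  proof (intro sum_mono mult_left_mono avg)
    fix L assume "L \<in> \<L>"
    then show "card L \<le> m" using card_mono[of "locations m" L] by (simp add: \<L>_def locations_def)
  qed simp
  \<comment> \<open>With \<open>k\<close> outermost, each inner sum times \<open>\<alpha>\<close> is
    bounded by the same \<open>E\<close>.\<close>
  also have "\<dots> = (\<Sum>k=1..m. w k * (\<Sum>L\<in>\<L>. pmf B L * (g k (card L) * M k)))"
    unfolding sum_distrib_left by (subst sum.swap) (simp add: mult_ac)
  finally have "\<alpha> * (c * opt_value N m B r \<phi>)
      \<le> \<alpha> * (\<Sum>k=1..m. w k * (\<Sum>L\<in>\<L>. pmf B L * (g k (card L) * M k)))"
    using assms(7) by (intro mult_left_mono) auto
  also have "\<dots> = (\<Sum>k=1..m. w k * (\<alpha> * (\<Sum>L\<in>\<L>. pmf B L * (g k (card L) * M k))))"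
    by (subst sum_distrib_left) (simp only: mult.left_commute[of \<alpha>])
  also have "\<dots> \<le> (\<Sum>k=1..m. w k * E)"
    by (intro sum_mono mult_left_mono w(1) E)
  also have "\<dots> = (\<Sum>k=1..m. w k) * E" by (simp add: sum_distrib_right)
  also have "\<dots> \<le> log 2 (real m) * E"
  proof (intro mult_right_mono w(2))
    \<comment> \<open>Replacing the total weight by the logarithm requires \<open>E\<close> to be
      nonnegative; the bound for \<open>k = 1\<close> shows this.\<close>
    have "0 \<le> \<alpha> * (\<Sum>L\<in>\<L>. pmf B L * (g 1 (card L) * M 1))"
      using assms(7) by (intro mult_nonneg_nonneg sum_nonneg g0 M0) auto
    then show "0 \<le> E" using E[of 1] assms(5) by auto
  qed
  finally have "\<alpha> * (c * opt_value N m B r \<phi>) \<le> log 2 (real m) * E" .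
  moreover have "0 < log 2 (real m)" using assms(5) by simp
  ultimately show ?thesis unfolding E_def[symmetric] c_def[symmetric] by (simp add: field_simps)
qed

end
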